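(* Let $\mathbf{F}$ be a field of characteristic $2$. Then: (i) if $\mathbf{F}=\mathbb{F}_{2^{2k+1}}$, then the smooth cubic surface $x^2t+y^2z+z^2y+t^2x=0$ in $\mathbb{P}^3_{\mathbf{F}}$ is not isomorphic over $\mathbf{F}$ to the Fermat cubic surface $x^3+y^3+z^3+t^3=0$ in $\mathbb{P}^3_{\mathbf{F}}$; (ii) if $\mathbf{F}=\mathbb{F}_{4^k}$ or $\mathbf{F}=\overline{\mathbf{F}}$, then the smooth cubic surface $x^2t+y^2z+z^2y+t^2x=0$ and the Fermat cubic surface $x^3+y^3+z^3+t^3=0$ in $\mathbb{P}^3_{\mathbf{F}}$ are isomorphic over $\mathbf{F}$.
   Context: Here $k\geqslant 0$ in $\mathbb{F}_{2^{2k+1}}$ and $k\geqslant 1$ in $\mathbb{F}_{4^k}$; $\overline{\mathbf{F}}$ denotes the algebraic closure of $\mathbf{F}$, so $\mathbf{F}=\overline{\mathbf{F}}$ means that $\mathbf{F}$ is algebraically closed. *)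

theory Defs
  imports
    "HOL-Analysis.Finite_Cartesian_Product"
    "HOL-Library.Poly_Mapping"
    "HOL-Library.Numeral_Type"
    "HOL-Algebra.Algebraic_Closure_Type"
begin

(* Projective varieties over a field F are handled classically: a polynomial has coefficients in
   F = 'a, while points have coordinates in the algebraic closure 'a alg_closure.  Projective
   coordinates are indexed by a finite type 'n, so that P^3 corresponds to 'n = 4
   (with the indices 0, 1, 2, 3). *)

type_synonym ('n, 'a) mpoly = "('n \<Rightarrow>\<^sub>0 nat) \<Rightarrow>\<^sub>0 'a"

definition indet :: "'n \<Rightarrow> ('n, 'a::field) mpoly" where
  "indet i = Poly_Mapping.single (Poly_Mapping.single i 1) 1"

definition homogeneous :: "nat \<Rightarrow> ('n::finite, 'a::field) mpoly \<Rightarrow> bool" where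
  "homogeneous d p \<longleftrightarrow>
     (\<forall>m \<in> Poly_Mapping.keys p. (\<Sum>i\<in>UNIV. Poly_Mapping.lookup m i) = d)"

definition eval_ac :: "('n::finite, 'a::field) mpoly \<Rightarrow> 'a alg_closure ^ 'n \<Rightarrow> 'a alg_closure" where
  "eval_ac p v =
     (\<Sum>m \<in> Poly_Mapping.keys p.
        to_ac (Poly_Mapping.lookup p m) * (\<Prod>i\<in>UNIV. (v $ i) ^ Poly_Mapping.lookup m i))"

(* If the exponent of the variable i in m is 0, then the truncated subtraction is harmless,
   because the coefficient vanishes. *)
definition partial_deriv :: "'n \<Rightarrow> ('n, 'a::field) mpoly \<Rightarrow> ('n, 'a) mpoly" where
  "partial_deriv i p =
     (\<Sum>m \<in> Poly_Mapping.keys p.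
        Poly_Mapping.single (m - Poly_Mapping.single i 1)
          (of_nat (Poly_Mapping.lookup m i) * Poly_Mapping.lookup p m))"

(* The point [v] of projective space, as the line spanned by v with the origin removed;
   it is a genuine point only for v \<noteq> 0. *)
definition proj_point :: "'k::field ^ 'n \<Rightarrow> ('k ^ 'n) set" where
  "proj_point v = {c *s v | c. c \<noteq> 0}"

(* The geometric points of the projective hypersurface f = 0, for homogeneous f. *)
definition hypersurface :: "('n::finite, 'a::field) mpoly \<Rightarrow> ('a alg_closure ^ 'n) set set" where
  "hypersurface f = {proj_point v | v. v \<noteq> 0 \<and> eval_ac f v = 0}"

(* Jacobian criterion at every geometric point. *)
definition smooth_hypersurface :: "('n::finite, 'a::field) mpoly \<Rightarrow> bool" where
  "smooth_hypersurface f \<longleftrightarrow>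
     (\<forall>v. v \<noteq> 0 \<and> eval_ac f v = 0 \<longrightarrow> (\<exists>i. eval_ac (partial_deriv i f) v \<noteq> 0))"

definition eval_tuple ::
    "('m \<Rightarrow> ('n::finite, 'a::field) mpoly) \<Rightarrow> 'a alg_closure ^ 'n \<Rightarrow> 'a alg_closure ^ 'm" where
  "eval_tuple g v = (\<chi> j. eval_ac (g j) v)"

(* A morphism over F between closed subvarieties of projective spaces: a map of geometric points
   which, in a Zariski neighbourhood of every point [v] of V, is given by a tuple of homogeneous
   polynomials of the same degree with coefficients in F.  The tuple may depend on the point;
   the neighbourhood is the open set of V where the tuple is not identically zero. *)
definition morphism_over ::
    "'a::field itself \<Rightarrow> ('a alg_closure ^ 'n::finite) set set \<Rightarrow> ('a alg_closure ^ 'm::finite) set set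
     \<Rightarrow> (('a alg_closure ^ 'n) set \<Rightarrow> ('a alg_closure ^ 'm) set) \<Rightarrow> bool" where
  "morphism_over F V W \<phi> \<longleftrightarrow>
     (\<forall>P \<in> V. \<phi> P \<in> W) \<and>
     (\<forall>v. v \<noteq> 0 \<and> proj_point v \<in> V \<longrightarrow>
        (\<exists>d (g :: 'm \<Rightarrow> ('n, 'a) mpoly).
           (\<forall>j. homogeneous d (g j)) \<and>
           eval_tuple g v \<noteq> 0 \<and>
           (\<forall>w. w \<noteq> 0 \<and> proj_point w \<in> V \<and> eval_tuple g w \<noteq> 0 \<longrightarrow>
              \<phi> (proj_point w) = proj_point (eval_tuple g w))))"

definition isomorphic_over ::
    "'a::field itself \<Rightarrow> ('a alg_closure ^ 'n::finite) set set \<Rightarrow> ('a alg_closure ^ 'm::finite) set set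
     \<Rightarrow> bool" where
  "isomorphic_over F V W \<longleftrightarrow>
     (\<exists>\<phi> \<psi>. morphism_over F V W \<phi> \<and> morphism_over F W V \<psi> \<and>
        (\<forall>P \<in> V. \<psi> (\<phi> P) = P) \<and> (\<forall>Q \<in> W. \<phi> (\<psi> Q) = Q))"

(* The homogeneous coordinates x, y, z, t are the variables 0, 1, 2, 3. *)

definition cubic_form :: "(4, 'a::field) mpoly" where
  "cubic_form =
     indet 0 ^ 2 * indet 3 + indet 1 ^ 2 * indet 2 + indet 2 ^ 2 * indet 1 + indet 3 ^ 2 * indet 0"

definition fermat_cubic_form :: "(4, 'a::field) mpoly" where
  "fermat_cubic_form = indet 0 ^ 3 + indet 1 ^ 3 + indet 2 ^ 3 + indet 3 ^ 3"

definition alg_closed_type :: "'a::field itself \<Rightarrow> bool" where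
  "alg_closed_type F \<longleftrightarrow> (\<forall>p :: 'a poly. Polynomial.degree p > 0 \<longrightarrow> (\<exists>x. poly p x = 0))"

end

theory Submission
  imports Defs
begin

text \<open>
  In characteristic 2 both surfaces have the same shape: with \<open>B(x,t) = x\<^sup>2t + t\<^sup>2x\<close>
  or \<open>B(x,t) = x\<^sup>3 + t\<^sup>3\<close>, the equation is \<open>B(x,t) = B(y,z)\<close>.

  If the field contains a primitive cube root of unity \<open>\<omega>\<close>, then both binary cubics are
  products of three distinct linear forms over the field, and the substitution
  \<open>(\<omega>\<^sup>2x + t, \<omega>x + t)\<close> carries one into the other.  Performing it on the pairs
  \<open>(x,t)\<close> and \<open>(y,z)\<close> gives a linear isomorphism of the surfaces
  (\<open>isomorphic_over_if_omega\<close>).  Such an \<open>\<omega>\<close> exists in every algebraically closed field, and in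
  every field with \<open>4\<^sup>k\<close> elements because \<open>3\<close> divides \<open>4\<^sup>k - 1\<close>.

  For a field with \<open>q = 2\<^bsup>2k+1\<^esup>\<close> elements the surfaces are told apart by their numbers of
  rational points.  A morphism over \<open>F\<close> is given locally by polynomials with coefficients in \<open>F\<close>
  and hence preserves rational points, so isomorphic surfaces have equally many of them, and also
  equally many zeros in \<open>F\<^sup>4\<close> (\<open>card_rational_zeros_eq\<close>).  The number of zeros of
  \<open>B(x,t) = B(y,z)\<close> is \<open>\<Sum>\<^sub>c n(c)\<^sup>2\<close>, where \<open>n(c)\<close> counts the pairs with \<open>B(x,t) = c\<close>.  As the
  \<open>q\<close> numbers \<open>n(c)\<close> add up to \<open>q\<^sup>2\<close>, this sum is \<open>q\<^sup>3\<close> if all of them are equal and larger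
  otherwise (\<open>card_collisions_equal_fibres\<close>, \<open>card_collisions_greater\<close>).
  Here \<open>q \<equiv> 2\<close> modulo \<open>3\<close>, so cubing is a bijection and
  the fibres of \<open>x\<^sup>3 + t\<^sup>3\<close> all have \<open>q\<close> elements; but \<open>x\<^sup>2t + t\<^sup>2x\<close> vanishes on
  both axes, which already have more than \<open>q\<close> points.

  Smoothness is immediate: the partial derivatives are \<open>t\<^sup>2\<close>, \<open>z\<^sup>2\<close>, \<open>y\<^sup>2\<close> and \<open>x\<^sup>2\<close>.
\<close>

(* The symbol $ is to denote vector components only. *)
no_notation fps_nth (infixl \<open>$\<close> 75)

section \<open>Evaluating and differentiating polynomials\<close>

lemma eval_ac_eq_sum:
  fixes p :: "('n::finite, 'a::field) mpoly"
  assumes "finite K" "Poly_Mapping.keys p \<subseteq> K"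
  shows "eval_ac p v =
    (\<Sum>m\<in>K. to_ac (Poly_Mapping.lookup p m) * (\<Prod>i\<in>UNIV. (v $ i) ^ Poly_Mapping.lookup m i))"
  unfolding eval_ac_def
  by (rule sum.mono_neutral_left) (use assms in \<open>auto simp: in_keys_iff\<close>)

lemma eval_ac_add: "eval_ac (p + q) v = eval_ac p v + eval_ac q v"
proof -
  let ?K = "Poly_Mapping.keys p \<union> Poly_Mapping.keys q"
  have "Poly_Mapping.keys (p + q) \<subseteq> ?K"
    by (rule keys_add)
  then show ?thesis
    by (simp add: eval_ac_eq_sum[of ?K] lookup_add distrib_right sum.distrib)
qed

lemma eval_ac_single:
  "eval_ac (Poly_Mapping.single m c) v = to_ac c * (\<Prod>i\<in>UNIV. (v $ i) ^ Poly_Mapping.lookup m i)"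
  by (cases "c = 0") (simp_all add: eval_ac_def)

lemma prod_power_lookup_add:
  fixes v :: "'b::comm_semiring_1 ^ 'n::finite"
  shows "(\<Prod>i\<in>UNIV. (v $ i) ^ Poly_Mapping.lookup (m + n) i) =
    (\<Prod>i\<in>UNIV. (v $ i) ^ Poly_Mapping.lookup m i) * (\<Prod>i\<in>UNIV. (v $ i) ^ Poly_Mapping.lookup n i)"
  by (simp add: lookup_add power_add prod.distrib)

lemma prod_power_lookup_single:
  fixes v :: "'b::comm_semiring_1 ^ 'n::finite"
  shows "(\<Prod>i\<in>UNIV. (v $ i) ^ Poly_Mapping.lookup (Poly_Mapping.single j a) i) = (v $ j) ^ a"
proof -
  have "(\<Prod>i\<in>UNIV. (v $ i) ^ Poly_Mapping.lookup (Poly_Mapping.single j a) i) =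
      (\<Prod>i\<in>UNIV. if i = j then (v $ i) ^ a else 1)"
    by (rule prod.cong) (auto simp: lookup_single when_def)
  then show ?thesis
    by simp
qed

lemma indet_power:
  "indet i ^ n = Poly_Mapping.single (Poly_Mapping.single i n) 1"
  by (induction n) (simp_all add: indet_def mult_single flip: single_add)

lemma eval_ac_scale:
  assumes "homogeneous d p"
  shows "eval_ac p (c *s v) = c ^ d * eval_ac p v"
proof -
  have "(\<Prod>i\<in>UNIV. ((c *s v) $ i) ^ Poly_Mapping.lookup m i) =
      c ^ d * (\<Prod>i\<in>UNIV. (v $ i) ^ Poly_Mapping.lookup m i)"
    if "m \<in> Poly_Mapping.keys p" for m
    using assms that
    by (simp add: homogeneous_def power_mult_distrib prod.distrib flip: power_sum)
  then show ?thesis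
    by (simp add: eval_ac_def sum_distrib_left mult_ac)
qed

lemma homogeneous_add:
  assumes "homogeneous d p" "homogeneous d q"
  shows "homogeneous d (p + q)"
  using assms keys_add[of p q] by (auto simp: homogeneous_def)

lemma sum_lookup_single: "(\<Sum>i\<in>UNIV. Poly_Mapping.lookup (Poly_Mapping.single j a) i) = (a::nat)"
  for j :: "'n::finite"
proof -
  have "(\<Sum>i\<in>UNIV. Poly_Mapping.lookup (Poly_Mapping.single j a) i) =
      (\<Sum>i\<in>UNIV. if i = j then a else 0)"
    by (rule sum.cong) (auto simp: lookup_single when_def)
  then show ?thesis
    by simp
qed

lemma homogeneous_single:
  assumes "(\<Sum>i\<in>UNIV. Poly_Mapping.lookup m i) = d"
  shows "homogeneous d (Poly_Mapping.single m c)"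
  using assms by (cases "c = 0") (auto simp: homogeneous_def)

lemma partial_deriv_eq_sum:
  fixes p :: "('n::finite, 'a::field) mpoly"
  assumes "finite K" "Poly_Mapping.keys p \<subseteq> K"
  shows "partial_deriv i p =
    (\<Sum>m\<in>K. Poly_Mapping.single (m - Poly_Mapping.single i 1)
       (of_nat (Poly_Mapping.lookup m i) * Poly_Mapping.lookup p m))"
  unfolding partial_deriv_def
  by (rule sum.mono_neutral_left) (use assms in \<open>auto simp: in_keys_iff\<close>)

lemma partial_deriv_add:
  "partial_deriv i (p + q) = partial_deriv i p + (partial_deriv i q :: ('n::finite, 'a::field) mpoly)"
proof -
  let ?K = "Poly_Mapping.keys p \<union> Poly_Mapping.keys q"
  have "Poly_Mapping.keys (p + q) \<subseteq> ?K"
    by (rule keys_add)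
  then show ?thesis
    by (simp add: partial_deriv_eq_sum[of ?K] lookup_add distrib_left single_add sum.distrib)
qed

lemma partial_deriv_single:
  "partial_deriv i (Poly_Mapping.single m c :: ('n::finite, 'a::field) mpoly) =
    Poly_Mapping.single (m - Poly_Mapping.single i 1) (of_nat (Poly_Mapping.lookup m i) * c)"
  by (cases "c = 0") (simp_all add: partial_deriv_def)


section \<open>The two cubic forms\<close>

lemma UNIV_4_from_0: "(UNIV :: 4 set) = {0, 1, 2, 3}"
proof (rule sym, rule card_subset_eq)
  show "card {0, 1, 2, 3::4} = card (UNIV :: 4 set)"
    by simp
qed auto

lemma all_4_iff: "(\<forall>i::4. P i) \<longleftrightarrow> P 0 \<and> P 1 \<and> P 2 \<and> P 3"
  using UNIV_4_from_0 by (metis UNIV_I empty_iff insert_iff)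

lemma vec_4_eq_iff: "(v :: 'b ^ 4) = w \<longleftrightarrow> v $ 0 = w $ 0 \<and> v $ 1 = w $ 1 \<and> v $ 2 = w $ 2 \<and> v $ 3 = w $ 3"
  by (simp add: vec_eq_iff all_4_iff)

lemma cubic_form_monomials:
  "cubic_form =
    Poly_Mapping.single (Poly_Mapping.single 0 2 + Poly_Mapping.single 3 1) 1 +
    Poly_Mapping.single (Poly_Mapping.single 1 2 + Poly_Mapping.single 2 1) 1 +
    Poly_Mapping.single (Poly_Mapping.single 2 2 + Poly_Mapping.single 1 1) 1 +
    Poly_Mapping.single (Poly_Mapping.single 3 2 + Poly_Mapping.single 0 1) 1"
  unfolding cubic_form_def indet_power by (simp add: indet_def mult_single)

lemma eval_cubic_form:
  "eval_ac cubic_form v = (v $ 0)\<^sup>2 * v $ 3 + (v $ 1)\<^sup>2 * v $ 2 + (v $ 2)\<^sup>2 * v $ 1 + (v $ 3)\<^sup>2 * v $ 0"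
  unfolding cubic_form_monomials
  by (simp only: eval_ac_add eval_ac_single prod_power_lookup_add prod_power_lookup_single) simp

lemma eval_fermat_cubic_form:
  "eval_ac fermat_cubic_form v = (v $ 0) ^ 3 + (v $ 1) ^ 3 + (v $ 2) ^ 3 + (v $ 3) ^ 3"
  unfolding fermat_cubic_form_def indet_power
  by (simp only: eval_ac_add eval_ac_single prod_power_lookup_single) simp

text \<open>
  Among the exponent vectors is \<open>Poly_Mapping.single 0 2\<close>, the square of the variable with index
  \<open>0\<close>.  The simplification rule \<open>single_numeral\<close> turns it into the numeral \<open>2\<close>, on which the
  rules for \<open>single\<close> no longer act; hence its removal in the proofs below.
\<close>

lemma homogeneous_cubic_form: "homogeneous 3 cubic_form"
  unfolding cubic_form_monomials
  by (intro homogeneous_add homogeneous_single) (simp_all add: lookup_add sum.distrib sum_lookup_single del: single_numeral)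

lemma homogeneous_fermat_cubic_form: "homogeneous 3 fermat_cubic_form"
  unfolding fermat_cubic_form_def indet_power
  by (intro homogeneous_add homogeneous_single) (simp_all add: sum_lookup_single del: single_numeral)

lemma two_eq_0_if_CHAR_2:
  assumes "CHAR('a::ring_1) = 2"
  shows "(2::'a) = 0"
  using assms of_nat_CHAR[where ?'a = 'a] by simp

lemma partial_deriv_cubic_form:
  assumes "CHAR('a::field) = 2"
  shows "partial_deriv 0 (cubic_form :: (4, 'a) mpoly) = indet 3 ^ 2"
    and "partial_deriv 1 (cubic_form :: (4, 'a) mpoly) = indet 2 ^ 2"
    and "partial_deriv 2 (cubic_form :: (4, 'a) mpoly) = indet 1 ^ 2"
    and "partial_deriv 3 (cubic_form :: (4, 'a) mpoly) = indet 0 ^ 2"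
  unfolding cubic_form_monomials indet_power
  by (simp_all only: partial_deriv_add partial_deriv_single lookup_add)
     (simp_all add: lookup_single two_eq_0_if_CHAR_2[OF assms] del: single_numeral)

lemma smooth_cubic_form:
  assumes "CHAR('a::field) = 2"
  shows "smooth_hypersurface (cubic_form :: (4, 'a) mpoly)"
  unfolding smooth_hypersurface_def
proof (intro allI impI)
  fix v :: "'a alg_closure ^ 4"
  assume "v \<noteq> 0 \<and> eval_ac cubic_form v = 0"
  then consider "v $ 0 \<noteq> 0" | "v $ 1 \<noteq> 0" | "v $ 2 \<noteq> 0" | "v $ 3 \<noteq> 0"
    by (auto simp: vec_4_eq_iff)
  moreover have "eval_ac (indet i ^ 2) v = (v $ i)\<^sup>2" for i
    unfolding indet_power eval_ac_single prod_power_lookup_single by simp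
  ultimately show "\<exists>i. eval_ac (partial_deriv i (cubic_form :: (4, 'a) mpoly)) v \<noteq> 0"
    by (metis partial_deriv_cubic_form[OF assms] power2_eq_square mult_eq_0_iff)
qed


section \<open>Projective points and linear isomorphisms\<close>

lemma proj_point_nonempty: "v \<in> proj_point v"
  unfolding proj_point_def by (auto intro: exI[of _ 1])

lemma proj_point_eq_image: "proj_point v = (\<lambda>c. c *s v) ` (- {0})"
  by (auto simp: proj_point_def)

lemma proj_point_eq_iff: "proj_point v = proj_point w \<longleftrightarrow> (\<exists>c. c \<noteq> 0 \<and> v = c *s w)"
proof
  assume "proj_point v = proj_point w"
  then show "\<exists>c. c \<noteq> 0 \<and> v = c *s w"
    using proj_point_nonempty[of v] by (auto simp: proj_point_def)
next
  assume "\<exists>c. c \<noteq> 0 \<and> v = c *s w"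
  then obtain c where c: "c \<noteq> 0" "v = c *s w"
    by blast
  have "d *s w \<in> proj_point v" if "d \<noteq> 0" for d
    using that c by (auto simp: proj_point_def vector_smult_assoc intro!: exI[of _ "d / c"])
  with c show "proj_point v = proj_point w"
    by (auto simp: proj_point_def vector_smult_assoc)
qed

lemma proj_point_in_hypersurface_iff:
  assumes "homogeneous d f" "v \<noteq> 0"
  shows "proj_point v \<in> hypersurface f \<longleftrightarrow> eval_ac f v = 0"
proof
  assume "proj_point v \<in> hypersurface f"
  then show "eval_ac f v = 0"
    using assms(1) by (auto simp: hypersurface_def proj_point_eq_iff eval_ac_scale)
next
  assume "eval_ac f v = 0"
  then show "proj_point v \<in> hypersurface f"
    using assms(2) by (auto simp: hypersurface_def)
qed

lemma eval_tuple_scale: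
  assumes "\<And>j. homogeneous 1 (g j)"
  shows "eval_tuple g (c *s v) = c *s eval_tuple g v"
  using eval_ac_scale[OF assms] by (simp add: eval_tuple_def vec_eq_iff)

lemma image_eval_tuple_proj_point:
  assumes "\<And>j. homogeneous 1 (g j)"
  shows "eval_tuple g ` proj_point v = proj_point (eval_tuple g v)"
  by (simp add: proj_point_eq_image image_image eval_tuple_scale[of g, OF assms])

text \<open>
  A left inverse of the substitution \<open>g\<close> keeps nonzero vectors nonzero, so the image of a line
  without the origin under \<open>g\<close> is again a projective point.
\<close>

lemma morphism_over_linear:
  fixes f :: "('n::finite, 'a::field) mpoly" and f' :: "('m::finite, 'a) mpoly"
  assumes hom: "\<And>j. homogeneous 1 (g j)" "\<And>i. homogeneous 1 (h i)"
    and left_inv: "\<And>v. eval_tuple h (eval_tuple g v) = v"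
    and zero: "\<And>v. eval_ac f v = 0 \<Longrightarrow> eval_ac f' (eval_tuple g v) = 0"
  shows "morphism_over TYPE('a) (hypersurface f) (hypersurface f') (\<lambda>P. eval_tuple g ` P)"
proof -
  have nonzero: "eval_tuple g v \<noteq> 0" if "v \<noteq> 0" for v
  proof
    assume "eval_tuple g v = 0"
    then have "v = eval_tuple h (0 *s 0)"
      using left_inv[of v] by simp
    also have "\<dots> = 0"
      unfolding eval_tuple_scale[of h, OF hom(2)] by simp
    finally show False
      using that by simp
  qed
  have "eval_tuple g ` P \<in> hypersurface f'" if P: "P \<in> hypersurface f" for P
  proof -
    obtain v where v: "P = proj_point v" "v \<noteq> 0" "eval_ac f v = 0"
      using P by (auto simp: hypersurface_def)
    then have "eval_tuple g ` P = proj_point (eval_tuple g v)"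
      by (simp add: image_eval_tuple_proj_point[of g, OF hom(1)])
    with nonzero[OF v(2)] zero[OF v(3)] show ?thesis
      unfolding hypersurface_def by blast
  qed
  moreover have "\<exists>d (g' :: 'm \<Rightarrow> ('n, 'a) mpoly). (\<forall>j. homogeneous d (g' j)) \<and> eval_tuple g' v \<noteq> 0 \<and>
      (\<forall>w. w \<noteq> 0 \<and> proj_point w \<in> hypersurface f \<and> eval_tuple g' w \<noteq> 0 \<longrightarrow>
        eval_tuple g ` proj_point w = proj_point (eval_tuple g' w))" if "v \<noteq> 0" for v
    using that nonzero hom(1) image_eval_tuple_proj_point[of g, OF hom(1)]
    by (intro exI[of _ 1] exI[of _ g]) simp
  ultimately show ?thesis
    by (auto simp: morphism_over_def)
qed

lemma isomorphic_over_linear: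
  fixes f :: "('n::finite, 'a::field) mpoly" and f' :: "('m::finite, 'a) mpoly"
  assumes hom: "\<And>j. homogeneous 1 (g j)" "\<And>i. homogeneous 1 (h i)"
    and inv: "\<And>v. eval_tuple h (eval_tuple g v) = v" "\<And>w. eval_tuple g (eval_tuple h w) = w"
    and zero: "\<And>v. eval_ac f' (eval_tuple g v) = 0 \<longleftrightarrow> eval_ac f v = 0"
  shows "isomorphic_over TYPE('a) (hypersurface f) (hypersurface f')"
  unfolding isomorphic_over_def
proof (intro exI[of _ "\<lambda>P. eval_tuple g ` P"] exI[of _ "\<lambda>P. eval_tuple h ` P"] conjI)
  show "morphism_over TYPE('a) (hypersurface f) (hypersurface f') ((`) (eval_tuple g))"
    by (rule morphism_over_linear[OF hom inv(1)]) (simp add: zero)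
  show "morphism_over TYPE('a) (hypersurface f') (hypersurface f) ((`) (eval_tuple h))"
    by (rule morphism_over_linear[OF hom(2,1) inv(2)]) (metis zero inv(2))
qed (simp_all add: image_image inv)

text \<open>
  With \<open>a = \<omega>\<^sup>2x + t\<close> and \<open>b = \<omega>x + t\<close> one has \<open>a\<^sup>3 + b\<^sup>3 = x\<^sup>2t + t\<^sup>2x\<close>, and
  \<open>x = a + b\<close>, \<open>t = \<omega>a + \<omega>\<^sup>2b\<close>.
\<close>

lemma isomorphic_over_if_omega:
  fixes \<omega> :: "'a::field"
  assumes char: "CHAR('a) = 2" and omega: "\<omega>\<^sup>2 + \<omega> + 1 = 0"
  shows "isomorphic_over TYPE('a) (hypersurface (cubic_form :: (4, 'a) mpoly))
    (hypersurface (fermat_cubic_form :: (4, 'a) mpoly))"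
proof -
  define lin :: "'a \<Rightarrow> 4 \<Rightarrow> 'a \<Rightarrow> 4 \<Rightarrow> (4, 'a) mpoly" where
    "lin a i b j = Poly_Mapping.single (Poly_Mapping.single i 1) a +
      Poly_Mapping.single (Poly_Mapping.single j 1) b" for a i b j
  have hom_lin: "homogeneous 1 (lin a i b j)" for a i b j
    unfolding lin_def by (intro homogeneous_add homogeneous_single sum_lookup_single)
  have eval_lin: "eval_ac (lin a i b j) v = to_ac a * v $ i + to_ac b * v $ j" for a i b j v
    unfolding lin_def eval_ac_add eval_ac_single prod_power_lookup_single by simp
  define g where "g k = (if k = 0 then lin (\<omega>\<^sup>2) 0 1 3 else if k = 1 then lin (\<omega>\<^sup>2) 1 1 2
      else if k = 2 then lin \<omega> 1 1 2 else lin \<omega> 0 1 3)" for k :: 4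
  define h where "h k = (if k = 0 then lin 1 0 1 3 else if k = 1 then lin 1 1 1 2
      else if k = 2 then lin \<omega> 1 (\<omega>\<^sup>2) 2 else lin \<omega> 0 (\<omega>\<^sup>2) 3)" for k :: 4
  define W where "W = to_ac \<omega>"
  have W: "W\<^sup>2 + W + 1 = 0"
    unfolding W_def using omega by (metis to_ac_0 to_ac_1 to_ac_add to_ac_power)
  have two: "(2 :: 'a alg_closure) = 0"
    using two_eq_0_if_CHAR_2[OF char] by (metis to_ac_0 to_ac_numeral)
  have eval_g: "eval_tuple g v $ 0 = W\<^sup>2 * v $ 0 + v $ 3" "eval_tuple g v $ 1 = W\<^sup>2 * v $ 1 + v $ 2"
    "eval_tuple g v $ 2 = W * v $ 1 + v $ 2" "eval_tuple g v $ 3 = W * v $ 0 + v $ 3" for v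
    by (simp_all add: eval_tuple_def g_def eval_lin W_def)
  have eval_h: "eval_tuple h v $ 0 = v $ 0 + v $ 3" "eval_tuple h v $ 1 = v $ 1 + v $ 2"
    "eval_tuple h v $ 2 = W * v $ 1 + W\<^sup>2 * v $ 2" "eval_tuple h v $ 3 = W * v $ 0 + W\<^sup>2 * v $ 3" for v
    by (simp_all add: eval_tuple_def h_def eval_lin W_def)
  \<comment> \<open>Each identity exhibits the difference of its sides as a combination of \<open>W\<^sup>2 + W + 1\<close> and \<open>2\<close>.\<close>
  have hg: "(W\<^sup>2 * x + t) + (W * x + t) = x" for x t
  proof -
    have "(W\<^sup>2 * x + t) + (W * x + t) = x + (W\<^sup>2 + W + 1) * x + 2 * (t - x)"
      by (simp add: algebra_simps power2_eq_square power3_eq_cube)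
    then show ?thesis
      unfolding W two by simp
  qed
  have hg': "W * (W\<^sup>2 * x + t) + W\<^sup>2 * (W * x + t) = t" for x t
  proof -
    have "W * (W\<^sup>2 * x + t) + W\<^sup>2 * (W * x + t) = t + (W\<^sup>2 + W + 1) * t + 2 * (W ^ 3 * x - t)"
      by (simp add: algebra_simps power2_eq_square power3_eq_cube)
    then show ?thesis
      unfolding W two by simp
  qed
  have gh: "W\<^sup>2 * (x + t) + (W * x + W\<^sup>2 * t) = x" for x t
  proof -
    have "W\<^sup>2 * (x + t) + (W * x + W\<^sup>2 * t) = x + (W\<^sup>2 + W + 1) * x + 2 * (W\<^sup>2 * t - x)"
      by (simp add: algebra_simps power2_eq_square power3_eq_cube)
    then show ?thesis
      unfolding W two by simp
  qed
  have gh': "W * (x + t) + (W * x + W\<^sup>2 * t) = t" for x t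
  proof -
    have "W * (x + t) + (W * x + W\<^sup>2 * t) = t + (W\<^sup>2 + W + 1) * t + 2 * (W * x - t)"
      by (simp add: algebra_simps power2_eq_square power3_eq_cube)
    then show ?thesis
      unfolding W two by simp
  qed
  have binary: "(W\<^sup>2 * x + t) ^ 3 + (W * x + t) ^ 3 = x\<^sup>2 * t + t\<^sup>2 * x" for x t
  proof -
    have "(W\<^sup>2 * x + t) ^ 3 + (W * x + t) ^ 3 = x\<^sup>2 * t + t\<^sup>2 * x
        + (W\<^sup>2 + W + 1) * (W ^ 3 * (W - 1) * x ^ 3 + 3 * (W\<^sup>2 - W + 1) * x\<^sup>2 * t + 3 * x * t\<^sup>2)
        + 2 * (W ^ 3 * x ^ 3 - 2 * x\<^sup>2 * t - 2 * x * t\<^sup>2 + t ^ 3)"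
      by (simp add: algebra_simps power2_eq_square power3_eq_cube)
    then show ?thesis
      unfolding W two by simp
  qed
  show ?thesis
  proof (rule isomorphic_over_linear)
    fix v :: "'a alg_closure ^ 4"
    show "eval_tuple h (eval_tuple g v) = v" "eval_tuple g (eval_tuple h v) = v"
      by (simp_all add: vec_4_eq_iff eval_g eval_h hg hg' gh gh')
    have "eval_ac fermat_cubic_form (eval_tuple g v) =
        ((W\<^sup>2 * v $ 0 + v $ 3) ^ 3 + (W * v $ 0 + v $ 3) ^ 3) +
        ((W\<^sup>2 * v $ 1 + v $ 2) ^ 3 + (W * v $ 1 + v $ 2) ^ 3)"
      unfolding eval_fermat_cubic_form eval_g by (simp only: ac_simps)
    also have "\<dots> = eval_ac cubic_form v"
      unfolding binary eval_cubic_form by (simp only: ac_simps)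
    finally have "eval_ac fermat_cubic_form (eval_tuple g v) = eval_ac cubic_form v" .
    then show "eval_ac fermat_cubic_form (eval_tuple g v) = 0 \<longleftrightarrow> eval_ac cubic_form v = 0"
      by simp
  qed (simp_all add: g_def h_def hom_lin[simplified])
qed


section \<open>Cubes in finite fields\<close>

text \<open>
  Multiplication by \<open>x\<close> permutes the \<open>q - 1\<close> nonzero elements, so their product absorbs the
  factor \<open>x ^ (q - 1)\<close>.
\<close>

lemma power_card_minus_1_eq_1:
  fixes x :: "'a::field"
  assumes "finite (UNIV :: 'a set)" "x \<noteq> 0"
  shows "x ^ (CARD('a) - 1) = 1"
proof -
  let ?P = "\<Prod>(UNIV - {0 :: 'a})"
  have "x ^ (CARD('a) - 1) * ?P = (\<Prod>y\<in>UNIV - {0}. x * y)"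
    using assms(1) by (simp add: prod.distrib card_Diff_singleton)
  also have "\<dots> = ?P"
    by (rule prod.reindex_bij_witness[of _ "\<lambda>y. y / x" "\<lambda>y. x * y"]) (use assms(2) in auto)
  finally show ?thesis
    using assms(1) by simp
qed

text \<open>
  The equation \<open>x ^ ((q - 1) / 3) = 1\<close> has too few roots to hold for all nonzero \<open>x\<close>.  If it
  fails for \<open>x\<close>, then its left-hand side is a cube root of unity other than \<open>1\<close>.
\<close>

lemma primitive_cube_root_if_3_dvd:
  assumes fin: "finite (UNIV :: 'a::field set)" and dvd: "3 dvd CARD('a) - 1"
  obtains \<omega> :: "'a::field" where "\<omega>\<^sup>2 + \<omega> + 1 = 0"
proof -
  obtain m where m: "CARD('a) - 1 = 3 * m"
    using dvd by blast
  have "card {0, 1 :: 'a} \<le> CARD('a)"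
    by (rule card_mono[OF fin]) simp
  then have "m > 0"
    using m by (cases "m = 0") auto
  define p :: "'a poly" where "p = Polynomial.monom 1 m - 1"
  have poly_p: "poly p x = x ^ m - 1" for x
    by (simp add: p_def poly_monom)
  have "p \<noteq> 0"
    using poly_p[of 0] \<open>m > 0\<close> by (auto simp: power_0_left)
  have "Polynomial.degree p \<le> m"
    unfolding p_def by (rule degree_diff_le[OF degree_monom_le]) simp
  have "\<exists>x :: 'a. x \<noteq> 0 \<and> x ^ m \<noteq> 1"
  proof (rule ccontr)
    assume "\<not> ?thesis"
    then have "x ^ m = 1" if "x \<noteq> 0" for x :: 'a
      using that by blast
    then have "UNIV - {0 :: 'a} \<subseteq> {x. poly p x = 0}"
      by (intro subsetI) (simp add: poly_p)
    then have "card (UNIV - {0 :: 'a}) \<le> card {x. poly p x = 0}"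
      by (intro card_mono) (use fin in \<open>auto intro: finite_subset[OF subset_UNIV]\<close>)
    also have "\<dots> \<le> m"
      using card_poly_roots_bound[OF \<open>p \<noteq> 0\<close>] \<open>Polynomial.degree p \<le> m\<close> by linarith
    finally show False
      using m \<open>m > 0\<close> fin by (simp add: card_Diff_singleton)
  qed
  then obtain x :: 'a where x: "x \<noteq> 0" "x ^ m \<noteq> 1"
    by blast
  have "(x ^ m) ^ 3 = 1"
    using power_card_minus_1_eq_1[OF fin x(1)] unfolding m by (simp add: mult.commute flip: power_mult)
  then have "(x ^ m - 1) * ((x ^ m)\<^sup>2 + x ^ m + 1) = 0"
    by (simp add: algebra_simps power2_eq_square power3_eq_cube)
  then show thesis
    using x(2) that by auto
qed

lemma four_power_mod_3: "(4::nat) ^ k mod 3 = 1"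
proof (induction k)
  case (Suc k)
  then show ?case
    unfolding power_Suc by presburger
qed simp

text \<open>
  Since \<open>x ^ (2q - 1) = x\<close> and \<open>3\<close> divides \<open>2q - 1\<close>, every element is a cube, and a surjective
  map of a finite set to itself is injective.
\<close>

lemma bij_cube:
  assumes fin: "finite (UNIV :: 'a::field set)" and q: "CARD('a) mod 3 = 2"
  shows "bij (\<lambda>x :: 'a. x ^ 3)"
proof -
  obtain k where k: "CARD('a) = 3 * k + 2"
    using q by (metis mult_div_mod_eq)
  have "x = (x ^ (2 * k + 1)) ^ 3" for x :: 'a
  proof (cases "x = 0")
    case False
    have "x ^ (3 * k + 1) = 1"
      using power_card_minus_1_eq_1[OF fin False] k by simp
    then have "x ^ ((3 * k + 1) * 2 + 1) = x"
      by (simp add: power_mult del: mult_Suc)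
    moreover have "(3 * k + 1) * 2 + 1 = (2 * k + 1) * 3"
      by simp
    ultimately show ?thesis
      by (metis power_mult)
  qed simp
  then have "surj (\<lambda>x :: 'a. x ^ 3)"
    by (metis surjI)
  with finite_UNIV_surj_inj[OF fin] show ?thesis
    by (simp add: bij_def)
qed


section \<open>Rational points\<close>

definition ac_vec :: "'a::field ^ 'n \<Rightarrow> 'a alg_closure ^ 'n" where
  "ac_vec u = (\<chi> i. to_ac (u $ i))"

definition rational_zeros :: "('n::finite, 'a::field) mpoly \<Rightarrow> ('a ^ 'n) set" where
  "rational_zeros f = {u. u \<noteq> 0 \<and> eval_ac f (ac_vec u) = 0}"

definition rational_points :: "('n::finite, 'a::field) mpoly \<Rightarrow> ('a alg_closure ^ 'n) set set" where
  "rational_points f = (\<lambda>u. proj_point (ac_vec u)) ` rational_zeros f"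

lemma ac_vec_nth [simp]: "ac_vec u $ i = to_ac (u $ i)"
  by (simp add: ac_vec_def)

lemma ac_vec_eq_iff [simp]: "ac_vec u = ac_vec w \<longleftrightarrow> u = w"
  by (simp add: vec_eq_iff)

lemma ac_vec_eq_0_iff [simp]: "ac_vec u = 0 \<longleftrightarrow> u = 0"
  by (simp add: vec_eq_iff)

lemma ac_vec_scale: "ac_vec (c *s u) = to_ac c *s ac_vec u"
  by (simp add: vec_eq_iff)

lemma eval_tuple_rational:
  fixes g :: "'m::finite \<Rightarrow> ('n::finite, 'a::field) mpoly"
  obtains u' :: "'a ^ 'm" where "eval_tuple g (ac_vec u) = ac_vec u'"
proof -
  have "eval_ac p (ac_vec u) = to_ac (\<Sum>m \<in> Poly_Mapping.keys p.
      Poly_Mapping.lookup p m * (\<Prod>i\<in>UNIV. (u $ i) ^ Poly_Mapping.lookup m i))" for p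
    by (simp add: eval_ac_def to_ac_sum to_ac_prod)
  then have "eval_tuple g (ac_vec u) = ac_vec (\<chi> j. \<Sum>m \<in> Poly_Mapping.keys (g j).
      Poly_Mapping.lookup (g j) m * (\<Prod>i\<in>UNIV. (u $ i) ^ Poly_Mapping.lookup m i))"
    by (simp add: eval_tuple_def vec_eq_iff)
  then show thesis
    by (rule that)
qed

text \<open>
  Near a rational point the morphism is evaluation of polynomials with coefficients in the ground
  field, and these take rational vectors to rational vectors.
\<close>

lemma morphism_over_rational_points:
  fixes f :: "('n::finite, 'a::field) mpoly" and f' :: "('m::finite, 'a) mpoly"
  assumes mor: "morphism_over TYPE('a) (hypersurface f) (hypersurface f') \<phi>"
    and hom: "homogeneous d f'"
    and P: "P \<in> rational_points f"
  shows "\<phi> P \<in> rational_points f'"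
proof -
  obtain u where u: "u \<noteq> 0" "eval_ac f (ac_vec u) = 0" "P = proj_point (ac_vec u)"
    using P by (auto simp: rational_points_def rational_zeros_def)
  then have inV: "ac_vec u \<noteq> 0" "proj_point (ac_vec u) \<in> hypersurface f"
    by (auto simp: hypersurface_def)
  then obtain g :: "'m \<Rightarrow> ('n, 'a) mpoly" where g: "eval_tuple g (ac_vec u) \<noteq> 0"
      "\<phi> P = proj_point (eval_tuple g (ac_vec u))"
    using mor u(3) unfolding morphism_over_def by metis
  obtain u' where u': "eval_tuple g (ac_vec u) = ac_vec u'"
    by (rule eval_tuple_rational)
  have "proj_point (ac_vec u') \<in> hypersurface f'"
    using mor inV(2) u(3) g(2) u' by (auto simp: morphism_over_def)
  then have "u' \<in> rational_zeros f'"
    using g(1) u' hom by (simp add: rational_zeros_def proj_point_in_hypersurface_iff)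
  then show ?thesis
    using g(2) u' by (simp add: rational_points_def)
qed

lemma rational_points_subset: "rational_points f \<subseteq> hypersurface f"
  by (auto simp: rational_points_def rational_zeros_def hypersurface_def)

lemma finite_UNIV_vec:
  assumes "finite (UNIV :: 'b set)"
  shows "finite (UNIV :: ('b ^ 'n::finite) set)"
  by (rule card_ge_0_finite) (simp add: finite_UNIV_card_ge_0[OF assms])

text \<open>
  Every rational point is represented by exactly \<open>q - 1\<close> vectors over the ground field.
\<close>

lemma card_rational_zeros:
  fixes f :: "('n::finite, 'a::field) mpoly"
  assumes fin: "finite (UNIV :: 'a set)" and hom: "homogeneous d f"
  shows "card (rational_zeros f) = (CARD('a) - 1) * card (rational_points f)"
proof -
  let ?S = "rational_zeros f" and ?h = "\<lambda>u :: 'a ^ 'n. proj_point (ac_vec u)"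
  have "finite (UNIV :: ('a ^ 'n) set)"
    using fin by (rule finite_UNIV_vec)
  then have finS: "finite ?S"
    by (rule finite_subset[OF subset_UNIV])
  have fibre: "card {w \<in> ?S. ?h w = P} = CARD('a) - 1" if P: "P \<in> rational_points f" for P
  proof -
    obtain u where u: "u \<noteq> 0" "eval_ac f (ac_vec u) = 0" "P = ?h u"
      using P by (auto simp: rational_points_def rational_zeros_def)
    obtain i where i: "u $ i \<noteq> 0"
      using u(1) by (auto simp: vec_eq_iff)
    have "{w \<in> ?S. ?h w = P} = (\<lambda>c. c *s u) ` (UNIV - {0})"
    proof (intro equalityI subsetI)
      fix w assume "w \<in> {w \<in> ?S. ?h w = P}"
      then obtain c where c: "ac_vec w = c *s ac_vec u" and "w \<noteq> 0"
        by (auto simp: u(3) proj_point_eq_iff rational_zeros_def)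
      \<comment> \<open>The scalar lies in the ground field, being a quotient of two rational coordinates.\<close>
      have "to_ac (w $ i) = c * to_ac (u $ i)"
        using c by (metis ac_vec_nth vector_smult_component)
      then have "c = to_ac (w $ i / u $ i)"
        using i by simp
      with c have "w = (w $ i / u $ i) *s u"
        by (metis ac_vec_eq_iff ac_vec_scale)
      moreover from this have "w $ i / u $ i \<noteq> 0"
        using \<open>w \<noteq> 0\<close> by (metis vector_smult_lzero)
      ultimately show "w \<in> (\<lambda>c. c *s u) ` (UNIV - {0})"
        by blast
    next
      fix w assume "w \<in> (\<lambda>c. c *s u) ` (UNIV - {0})"
      then obtain c where "c \<noteq> 0" "w = c *s u"
        by blast
      have "w \<noteq> 0"
        using i \<open>c \<noteq> 0\<close> \<open>w = c *s u\<close> by (auto simp: vec_eq_iff)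
      moreover have "eval_ac f (ac_vec w) = 0"
        using u(2) \<open>w = c *s u\<close> by (simp add: ac_vec_scale eval_ac_scale[OF hom])
      moreover have "?h w = P"
        unfolding u(3) proj_point_eq_iff \<open>w = c *s u\<close> ac_vec_scale
        using \<open>c \<noteq> 0\<close> by (intro exI[of _ "to_ac c"]) simp
      ultimately show "w \<in> {w \<in> ?S. ?h w = P}"
        by (simp add: rational_zeros_def)
    qed
    moreover have "inj_on (\<lambda>c. c *s u) (UNIV - {0})"
      using i by (auto simp: inj_on_def vec_eq_iff)
    ultimately show ?thesis
      using fin by (simp add: card_image card_Diff_singleton)
  qed
  have "card ?S = (\<Sum>P\<in>rational_points f. card {w \<in> ?S. ?h w = P})"
    unfolding rational_points_def card_eq_sum by (rule sum.image_gen[OF finS])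
  then show ?thesis
    by (simp add: fibre)
qed

lemma card_rational_zeros_eq:
  fixes f :: "('n::finite, 'a::field) mpoly" and f' :: "('m::finite, 'a) mpoly"
  assumes fin: "finite (UNIV :: 'a set)"
    and hom: "homogeneous d f" "homogeneous d' f'"
    and iso: "isomorphic_over TYPE('a) (hypersurface f) (hypersurface f')"
  shows "card (rational_zeros f) = card (rational_zeros f')"
proof -
  obtain \<phi> \<psi> where mor: "morphism_over TYPE('a) (hypersurface f) (hypersurface f') \<phi>"
      "morphism_over TYPE('a) (hypersurface f') (hypersurface f) \<psi>"
    and inv: "\<forall>P \<in> hypersurface f. \<psi> (\<phi> P) = P" "\<forall>Q \<in> hypersurface f'. \<phi> (\<psi> Q) = Q"
    using iso by (auto simp: isomorphic_over_def)
  have "bij_betw \<phi> (rational_points f) (rational_points f')"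
  proof (rule bij_betw_byWitness[of _ \<psi>])
    show "\<forall>P\<in>rational_points f. \<psi> (\<phi> P) = P" "\<forall>Q\<in>rational_points f'. \<phi> (\<psi> Q) = Q"
      using inv rational_points_subset by blast+
    show "\<phi> ` rational_points f \<subseteq> rational_points f'" "\<psi> ` rational_points f' \<subseteq> rational_points f"
      using morphism_over_rational_points[OF mor(1) hom(2)]
        morphism_over_rational_points[OF mor(2) hom(1)] by auto
  qed
  then have "card (rational_points f) = card (rational_points f')"
    by (rule bij_betw_same_card)
  then show ?thesis
    by (simp add: card_rational_zeros[OF fin hom(1)] card_rational_zeros[OF fin hom(2)])
qed


section \<open>Counting collisions\<close>

lemma card_collisions:
  fixes b :: "'p \<Rightarrow> 'c"
  assumes "finite A" "finite C" "b ` A \<subseteq> C"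
  shows "card {(x, y) \<in> A \<times> A. b x = b y} = (\<Sum>c\<in>C. card {x \<in> A. b x = c} ^ 2)"
proof -
  let ?S = "{(x, y) \<in> A \<times> A. b x = b y}"
  have "finite ?S"
    by (rule finite_subset[of _ "A \<times> A"]) (use assms(1) in auto)
  then have "card ?S = (\<Sum>c\<in>C. card {s \<in> ?S. b (fst s) = c})"
    unfolding card_eq_sum by (intro sum.group[symmetric]) (use assms in auto)
  also have "\<dots> = (\<Sum>c\<in>C. card ({x \<in> A. b x = c} \<times> {x \<in> A. b x = c}))"
    by (intro sum.cong refl arg_cong[of _ _ card]) auto
  finally show ?thesis
    by (simp add: card_cartesian_product power2_eq_square)
qed

lemma card_collisions_equal_fibres:
  assumes "finite A" "finite C" "b ` A \<subseteq> C" "\<And>c. c \<in> C \<Longrightarrow> card {x \<in> A. b x = c} = q"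
  shows "card {(x, y) \<in> A \<times> A. b x = b y} = q ^ 2 * card C"
  unfolding card_collisions[OF assms(1-3)] using assms(4) by simp

text \<open>
  If the average fibre has \<open>q\<close> elements, then the sum of the squared fibre sizes \<open>n\<close> exceeds
  \<open>q ^ 2 * card C\<close> by the sum of the squared deviations \<open>(n - q) ^ 2\<close>.
\<close>

lemma card_collisions_greater:
  assumes fin: "finite A" "finite C" and sub: "b ` A \<subseteq> C" and average: "card A = q * card C"
    and c0: "c0 \<in> C" "card {x \<in> A. b x = c0} \<noteq> q"
  shows "card {(x, y) \<in> A \<times> A. b x = b y} > q ^ 2 * card C"
proof -
  define n where "n c = int (card {x \<in> A. b x = c})" for c
  have "card A = (\<Sum>c\<in>C. card {x \<in> A. b x = c})"
    unfolding card_eq_sum by (rule sum.group[symmetric]) (use fin sub in auto)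
  then have sum_n: "(\<Sum>c\<in>C. n c) = int q * int (card C)"
    using average by (simp add: n_def flip: of_nat_sum of_nat_mult)
  have "0 < (n c0 - int q)\<^sup>2"
    using c0(2) by (simp add: n_def)
  also have "\<dots> \<le> (\<Sum>c\<in>C. (n c - int q)\<^sup>2)"
    by (rule member_le_sum) (use fin c0(1) in auto)
  also have "\<dots> = (\<Sum>c\<in>C. (n c)\<^sup>2 - 2 * int q * n c + (int q)\<^sup>2)"
    by (simp add: power2_diff algebra_simps)
  also have "\<dots> = (\<Sum>c\<in>C. (n c)\<^sup>2) - 2 * int q * (\<Sum>c\<in>C. n c) + int (card C) * (int q)\<^sup>2"
    by (simp add: sum.distrib sum_subtractf sum_distrib_left)
  also have "\<dots> = (\<Sum>c\<in>C. (n c)\<^sup>2) - int (q ^ 2 * card C)"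
    by (simp add: sum_n power2_eq_square)
  also have "(\<Sum>c\<in>C. (n c)\<^sup>2) = int (card {(x, y) \<in> A \<times> A. b x = b y})"
    unfolding card_collisions[OF fin sub] by (simp add: n_def)
  finally have "0 < int (card {(x, y) \<in> A \<times> A. b x = b y}) - int (q ^ 2 * card C)" .
  then show ?thesis
    by linarith
qed

text \<open>
  In characteristic 2, a zero of \<open>b (x, t) + b (y, z)\<close> is a collision of \<open>b\<close>; the origin is
  a zero of the form that \<open>rational_zeros\<close> leaves out.
\<close>

lemma card_rational_zeros_binary:
  fixes f :: "(4, 'a::field) mpoly" and b :: "'a \<times> 'a \<Rightarrow> 'a"
  assumes char: "CHAR('a) = 2" and fin: "finite (UNIV :: 'a set)" and b0: "b (0, 0) = 0"
    and eval: "\<And>u. eval_ac f (ac_vec u) = to_ac (b (u $ 0, u $ 3) + b (u $ 1, u $ 2))"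
  shows "Suc (card (rational_zeros f)) = card {(p, p') \<in> UNIV \<times> UNIV. b p = b p'}"
proof -
  have "finite (UNIV :: ('a ^ 4) set)"
    using fin by (rule finite_UNIV_vec)
  then have finS: "finite (rational_zeros f)"
    by (rule finite_subset[OF subset_UNIV])
  have sum_0_iff: "x + y = 0 \<longleftrightarrow> x = y" for x y :: 'a
    by (metis minus_CHAR_2[OF char] right_minus_eq)
  have zeros: "insert 0 (rational_zeros f) = {u. b (u $ 0, u $ 3) = b (u $ 1, u $ 2)}"
    unfolding rational_zeros_def eval to_ac_eq_0_iff sum_0_iff by (auto simp: b0)
  have "bij_betw (\<lambda>u :: 'a ^ 4. ((u $ 0, u $ 3), (u $ 1, u $ 2))) {u. b (u $ 0, u $ 3) = b (u $ 1, u $ 2)}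
      {(p, p') \<in> UNIV \<times> UNIV. b p = b p'}"
    by (rule bij_betw_byWitness[of _ "\<lambda>((x, t), (y, z)).
        (\<chi> i :: 4. if i = 0 then x else if i = 1 then y else if i = 2 then z else t)"])
      (auto simp: vec_4_eq_iff)
  from bij_betw_same_card[OF this]
  have "card (insert 0 (rational_zeros f)) = card {(p, p') \<in> UNIV \<times> UNIV. b p = b p'}"
    unfolding zeros .
  moreover have "0 \<notin> rational_zeros f"
    by (simp add: rational_zeros_def)
  ultimately show ?thesis
    using finS by (metis card_insert_disjoint)
qed


section \<open>Comparing the two surfaces\<close>

text \<open>
  For the Fermat form, \<open>t\<close> is determined by \<open>x\<close> and \<open>c\<close> in \<open>x\<^sup>3 + t\<^sup>3 = c\<close>, so all fibres
  have \<open>q\<close> elements; for the other form the fibre over \<open>0\<close> is larger.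
\<close>

lemma not_isomorphic_over_odd_degree:
  assumes char: "CHAR('a::field) = 2" and card: "CARD('a) = 2 ^ (2 * k + 1)"
  shows "\<not> isomorphic_over TYPE('a) (hypersurface (cubic_form :: (4, 'a) mpoly))
    (hypersurface (fermat_cubic_form :: (4, 'a) mpoly))"
proof
  assume iso: "isomorphic_over TYPE('a) (hypersurface (cubic_form :: (4, 'a) mpoly))
    (hypersurface (fermat_cubic_form :: (4, 'a) mpoly))"
  have fin: "finite (UNIV :: 'a set)"
    by (rule card_ge_0_finite) (simp add: card)
  have finA: "finite (UNIV :: ('a \<times> 'a) set)"
    using fin by (simp add: finite_prod)
  have "CARD('a) mod 3 = 2"
  proof -
    have "(2::nat) ^ (2 * k + 1) = (2\<^sup>2) ^ k * 2"
      by (simp only: power_add power_mult power_one_right)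
    then have "CARD('a) = 4 ^ k * 2"
      using card by simp
    then show ?thesis
      using four_power_mod_3[of k] by presburger
  qed
  then have bij: "bij (\<lambda>x :: 'a. x ^ 3)"
    by (rule bij_cube[OF fin])
  define b1 :: "'a \<times> 'a \<Rightarrow> 'a" where "b1 = (\<lambda>(x, t). x\<^sup>2 * t + t\<^sup>2 * x)"
  define b2 :: "'a \<times> 'a \<Rightarrow> 'a" where "b2 = (\<lambda>(x, t). x ^ 3 + t ^ 3)"
  let ?q = "CARD('a)"

  have "?q ^ 2 * ?q < card {(p, p') \<in> UNIV \<times> UNIV. b1 p = b1 p'}"
  proof (rule card_collisions_greater[of _ _ _ _ 0])
    \<comment> \<open>All \<open>q\<close> points of one axis together with a single point of the other one.\<close>
    let ?D = "insert (0, 1) ((\<lambda>x :: 'a. (x, 0 :: 'a)) ` UNIV)"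
    have "card ?D = Suc ?q"
      using fin by (subst card_insert_disjoint) (auto simp: card_image inj_on_def)
    moreover have "card ?D \<le> card {p \<in> UNIV. b1 p = 0}"
      by (rule card_mono) (use finA in \<open>auto simp: b1_def intro: finite_subset[OF subset_UNIV]\<close>)
    ultimately show "card {p \<in> UNIV. b1 p = 0} \<noteq> ?q"
      by simp
  qed (use fin finA in \<open>auto simp: card_prod\<close>)
  moreover have "card {(p, p') \<in> UNIV \<times> UNIV. b2 p = b2 p'} = ?q ^ 2 * ?q"
  proof (rule card_collisions_equal_fibres)
    fix c :: 'a
    obtain root :: "'a \<Rightarrow> 'a" where root: "root y ^ 3 = y" for y
      using bij_is_surj[OF bij] by (metis surjD)
    have root_cube: "root (y ^ 3) = y" for y
      using bij_is_inj[OF bij] root[of "y ^ 3"] by (rule injD)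
    have "{p \<in> UNIV. b2 p = c} = (\<lambda>x. (x, root (c - x ^ 3))) ` UNIV"
    proof (intro equalityI subsetI)
      fix p assume "p \<in> {p \<in> UNIV. b2 p = c}"
      then obtain x t where p: "p = (x, t)" and "x ^ 3 + t ^ 3 = c"
        by (cases p) (auto simp: b2_def)
      then have "root (c - x ^ 3) = t"
        using root_cube[of t] by (simp flip: \<open>x ^ 3 + t ^ 3 = c\<close>)
      with p show "p \<in> (\<lambda>x. (x, root (c - x ^ 3))) ` UNIV"
        by blast
    qed (auto simp: b2_def root)
    then show "card {p \<in> UNIV. b2 p = c} = ?q"
      by (simp add: card_image inj_on_def)
  qed (use fin finA in auto)
  moreover have "Suc (card (rational_zeros (cubic_form :: (4, 'a) mpoly))) =
      card {(p, p') \<in> UNIV \<times> UNIV. b1 p = b1 p'}"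
    by (rule card_rational_zeros_binary[OF char fin]) (simp_all add: b1_def eval_cubic_form)
  moreover have "Suc (card (rational_zeros (fermat_cubic_form :: (4, 'a) mpoly))) =
      card {(p, p') \<in> UNIV \<times> UNIV. b2 p = b2 p'}"
    by (rule card_rational_zeros_binary[OF char fin]) (simp_all add: b2_def eval_fermat_cubic_form)
  ultimately show False
    using card_rational_zeros_eq[OF fin homogeneous_cubic_form homogeneous_fermat_cubic_form iso]
    by simp
qed


theorem corollary1p7:
  assumes "CHAR('a::field) = 2"
  shows "smooth_hypersurface (cubic_form :: (4, 'a) mpoly) \<and>
    ((\<exists>k::nat. CARD('a) = 2 ^ (2 * k + 1)) \<longrightarrow>
       \<not> isomorphic_over TYPE('a)
           (hypersurface (cubic_form :: (4, 'a) mpoly))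
           (hypersurface (fermat_cubic_form :: (4, 'a) mpoly))) \<and>
    ((\<exists>k::nat. k \<ge> 1 \<and> CARD('a) = 4 ^ k) \<or> alg_closed_type TYPE('a) \<longrightarrow>
       isomorphic_over TYPE('a)
         (hypersurface (cubic_form :: (4, 'a) mpoly))
         (hypersurface (fermat_cubic_form :: (4, 'a) mpoly)))"
proof (intro conjI impI)
  show "smooth_hypersurface (cubic_form :: (4, 'a) mpoly)"
    by (rule smooth_cubic_form[OF assms])
next
  assume "\<exists>k::nat. CARD('a) = 2 ^ (2 * k + 1)"
  then show "\<not> isomorphic_over TYPE('a) (hypersurface (cubic_form :: (4, 'a) mpoly))
      (hypersurface (fermat_cubic_form :: (4, 'a) mpoly))"
    using not_isomorphic_over_odd_degree[OF assms] by blast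
next
  assume "(\<exists>k::nat. k \<ge> 1 \<and> CARD('a) = 4 ^ k) \<or> alg_closed_type TYPE('a)"
  then obtain \<omega> :: 'a where "\<omega>\<^sup>2 + \<omega> + 1 = 0"
  proof (elim disjE exE conjE)
    fix k :: nat
    assume card: "CARD('a) = 4 ^ k"
    have "finite (UNIV :: 'a set)"
      by (rule card_ge_0_finite) (simp add: card)
    moreover have "3 dvd CARD('a) - 1"
      using four_power_mod_3[of k] card by presburger
    ultimately show thesis
      by (rule primitive_cube_root_if_3_dvd) (rule that)
  next
    assume "alg_closed_type TYPE('a)"
    then obtain x :: 'a where "poly [:1, 1, 1:] x = 0"
      unfolding alg_closed_type_def by (elim allE[of _ "[:1, 1, 1:]"]) auto
    then show thesis
      by (intro that[of x]) (simp add: power2_eq_square algebra_simps)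
  qed
  then show "isomorphic_over TYPE('a) (hypersurface (cubic_form :: (4, 'a) mpoly))
      (hypersurface (fermat_cubic_form :: (4, 'a) mpoly))"
    by (rule isomorphic_over_if_omega[OF assms])
qed

end
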